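(* Let $n\ge 2$. For all $0\le k_1,\dots,k_n\le n-1$, $$E_n(k_1,\dots,k_n)=E_n(n-1-k_1,\dots,n-1-k_n).$$
   Context: $[n]=\{1,\dots,n\}$. An order-$n$ Latin square is an $n\times n$ matrix $L=(L(i,j))_{1\le i,j\le n}$ with entries in $[n]$ such that every row and every column is a permutation of $[n]$. An ascent of a permutation $\pi$ of $[n]$ is an index $i\in\{1,\dots,n-1\}$ with $\pi(i)<\pi(i+1)$. For a Latin square $L$ and $1\le i\le n$, $k_i(L)\in\{0,\dots,n-1\}$ is the number of ascents of the $i$-th column $(L(1,i),L(2,i),\dots,L(n,i))$ viewed as a permutation of $[n]$. For $\mathbf k=(k_1,\dots,k_n)\in\{0,\dots,n-1\}^n$, the Latin Eulerian number $E_n(k_1,\dots,k_n)$ is the number of order-$n$ Latin squares $L$ with $k_i(L)=k_i$ for all $i=1,\dots,n$. *)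

theory Defs
  imports "HOL-Library.FuncSet"
begin

(* A matrix is a function on index pairs with 1-based indices. It is required to be
   extensional (undefined outside {1..n} \<times> {1..n}), so that distinct functions are
   distinct matrices and counting functions counts matrices. *)
definition latin_squares :: "nat \<Rightarrow> (nat \<times> nat \<Rightarrow> nat) set" where
  "latin_squares n = {L \<in> {1..n} \<times> {1..n} \<rightarrow>\<^sub>E {1..n}.
     (\<forall>i\<in>{1..n}. bij_betw (\<lambda>j. L (i, j)) {1..n} {1..n}) \<and>
     (\<forall>j\<in>{1..n}. bij_betw (\<lambda>i. L (i, j)) {1..n} {1..n})}"

definition ascents :: "nat \<Rightarrow> (nat \<Rightarrow> nat) \<Rightarrow> nat set" where
  "ascents n \<pi> = {i \<in> {1..n - 1}. \<pi> i < \<pi> (i + 1)}"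

definition column_ascents :: "nat \<Rightarrow> (nat \<times> nat \<Rightarrow> nat) \<Rightarrow> nat \<Rightarrow> nat" where
  "column_ascents n L j = card (ascents n (\<lambda>i. L (i, j)))"

(* Only the values k 1, ..., k n matter. *)
definition latin_eulerian :: "nat \<Rightarrow> (nat \<Rightarrow> nat) \<Rightarrow> nat" where
  "latin_eulerian n k = card {L \<in> latin_squares n. \<forall>j\<in>{1..n}. column_ascents n L j = k j}"

(* Hence the cardinality in latin_eulerian is a genuine count. *)
lemma finite_latin_squares: "finite (latin_squares n)"
  unfolding latin_squares_def by (rule finite_Collect_conjI) (simp add: finite_PiE)

end

theory Submission
  imports Defs
begin

text \<open>
  Replacing every symbol \<open>x\<close> of a Latin square by \<open>n + 1 - x\<close> reverses the order of the symbols
  and therefore produces another Latin square.  Consecutive entries of a column are distinct, so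
  each of its \<open>n - 1\<close> adjacent pairs is either an ascent or a descent, and the reversal exchanges
  the two: a column with \<open>k\<close> ascents becomes one with \<open>n - 1 - k\<close> ascents.  As the replacement is
  an involution, it is a bijection between the Latin squares counted on the two sides.
\<close>

definition complement_square :: "nat \<Rightarrow> (nat \<times> nat \<Rightarrow> nat) \<Rightarrow> nat \<times> nat \<Rightarrow> nat" where
  "complement_square n L = (\<lambda>p\<in>{1..n} \<times> {1..n}. n + 1 - L p)"

lemma bij_betw_complement: "bij_betw (\<lambda>x. n + 1 - x) {1..n} {1..n::nat}"
  by (rule bij_betw_byWitness[where f' = "\<lambda>x. n + 1 - x"]) auto

lemma bij_betw_complement_comp:
  assumes "bij_betw \<pi> {1..n} {1..n::nat}"
  shows "bij_betw (\<lambda>i. n + 1 - \<pi> i) {1..n} {1..n}"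
  using bij_betw_trans[OF assms bij_betw_complement] by (simp add: o_def)

lemma complement_square_latin:
  assumes "L \<in> latin_squares n"
  shows "complement_square n L \<in> latin_squares n"
proof -
  have L: "L \<in> {1..n} \<times> {1..n} \<rightarrow>\<^sub>E {1..n}"
    and rows: "\<And>i. i \<in> {1..n} \<Longrightarrow> bij_betw (\<lambda>j. L (i, j)) {1..n} {1..n}"
    and cols: "\<And>j. j \<in> {1..n} \<Longrightarrow> bij_betw (\<lambda>i. L (i, j)) {1..n} {1..n}"
    using assms by (auto simp: latin_squares_def)
  have "complement_square n L \<in> {1..n} \<times> {1..n} \<rightarrow>\<^sub>E {1..n}"
    unfolding complement_square_def
  proof (rule restrict_PiE_iff[THEN iffD2], rule ballI)
    fix p assume "p \<in> {1..n} \<times> {1..n}"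
    with L have "L p \<in> {1..n}" by (rule PiE_mem)
    then show "n + 1 - L p \<in> {1..n}" by auto
  qed
  moreover have "bij_betw (\<lambda>j. complement_square n L (i, j)) {1..n} {1..n}" if "i \<in> {1..n}" for i
    by (rule bij_betw_cong[THEN iffD2, OF _ bij_betw_complement_comp[OF rows[OF that]]])
      (use that in \<open>simp add: complement_square_def\<close>)
  moreover have "bij_betw (\<lambda>i. complement_square n L (i, j)) {1..n} {1..n}" if "j \<in> {1..n}" for j
    by (rule bij_betw_cong[THEN iffD2, OF _ bij_betw_complement_comp[OF cols[OF that]]])
      (use that in \<open>simp add: complement_square_def\<close>)
  ultimately show ?thesis
    by (simp add: latin_squares_def)
qed

lemma complement_square_involution:
  assumes "L \<in> latin_squares n"
  shows "complement_square n (complement_square n L) = L"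
proof
  fix p
  have L: "L \<in> {1..n} \<times> {1..n} \<rightarrow>\<^sub>E {1..n}"
    using assms by (simp add: latin_squares_def)
  show "complement_square n (complement_square n L) p = L p"
  proof (cases "p \<in> {1..n} \<times> {1..n}")
    case True
    with L have "L p \<in> {1..n}" by (rule PiE_mem)
    with True show ?thesis by (simp add: complement_square_def)
  next
    case False
    with L have "L p = undefined" by (rule PiE_arb)
    with False show ?thesis by (simp add: complement_square_def)
  qed
qed

text \<open>
  Injectivity makes adjacent values distinct, so a non-ascent is a strict descent, which order
  reversal turns into an ascent.
\<close>
lemma ascents_complement:
  assumes "bij_betw \<pi> {1..n} {1..n}"
  shows "ascents n (\<lambda>i. n + 1 - \<pi> i) = {1..n - 1} - ascents n \<pi>"
proof -
  have "n + 1 - \<pi> i < n + 1 - \<pi> (i + 1) \<longleftrightarrow> \<not> \<pi> i < \<pi> (i + 1)" if "i \<in> {1..n - 1}" for i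
  proof -
    have dom: "i \<in> {1..n}" "i + 1 \<in> {1..n}"
      using that by auto
    then have "\<pi> i \<in> {1..n}" "\<pi> (i + 1) \<in> {1..n}"
      using bij_betwE[OF assms] by blast+
    moreover have "\<pi> i \<noteq> \<pi> (i + 1)"
      using inj_onD[OF bij_betw_imp_inj_on[OF assms] _ dom] by auto
    ultimately show ?thesis by auto
  qed
  then show ?thesis
    unfolding ascents_def by blast
qed

lemma column_ascents_complement_square:
  assumes "L \<in> latin_squares n" and "j \<in> {1..n}"
  shows "column_ascents n (complement_square n L) j = n - 1 - column_ascents n L j"
proof -
  have col: "bij_betw (\<lambda>i. L (i, j)) {1..n} {1..n}"
    using assms by (simp add: latin_squares_def)
  have "ascents n (\<lambda>i. complement_square n L (i, j)) = ascents n (\<lambda>i. n + 1 - L (i, j))"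
    using assms(2) unfolding ascents_def by (intro Collect_cong) (auto simp: complement_square_def)
  also have "\<dots> = {1..n - 1} - ascents n (\<lambda>i. L (i, j))"
    by (rule ascents_complement[OF col])
  finally have "column_ascents n (complement_square n L) j
      = card ({1..n - 1} - ascents n (\<lambda>i. L (i, j)))"
    by (simp add: column_ascents_def)
  also have "\<dots> = n - 1 - column_ascents n L j"
    by (subst card_Diff_subset) (auto simp: ascents_def column_ascents_def)
  finally show ?thesis .
qed

theorem proposition2p6:
  fixes n :: nat and k :: "nat \<Rightarrow> nat"
  assumes "n \<ge> 2"
    and "\<forall>i\<in>{1..n}. k i \<le> n - 1"
  shows "latin_eulerian n k = latin_eulerian n (\<lambda>i. n - 1 - k i)"
proof -
  let ?A = "\<lambda>k. {L \<in> latin_squares n. \<forall>j\<in>{1..n}. column_ascents n L j = k j}"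
  have maps: "complement_square n ` ?A k \<subseteq> ?A (\<lambda>i. n - 1 - k i)" for k
    by (auto simp: complement_square_latin column_ascents_complement_square)
  \<comment> \<open>Subtracting twice from \<open>n - 1\<close> gives back \<open>k i\<close> because \<open>k i \<le> n - 1\<close>;
    on natural numbers this would fail for a larger \<open>k i\<close>.\<close>
  have "n - 1 - (n - 1 - k j) = k j" if "j \<in> {1..n}" for j
    using assms(2) that by (intro diff_diff_cancel) blast
  then have "?A (\<lambda>i. n - 1 - (n - 1 - k i)) = ?A k"
    by (intro Collect_cong conj_cong ball_cong refl) metis
  with maps[of "\<lambda>i. n - 1 - k i"] have "complement_square n ` ?A (\<lambda>i. n - 1 - k i) \<subseteq> ?A k"
    by (elim subst)
  with maps[of k] have "bij_betw (complement_square n) (?A k) (?A (\<lambda>i. n - 1 - k i))"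
    by (intro bij_betw_byWitness[where f' = "complement_square n"])
      (blast intro: complement_square_involution)+
  then show ?thesis
    unfolding latin_eulerian_def by (rule bij_betw_same_card)
qed

end
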